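(* Consider the two treatment groups random coefficient regression model with $N$ individuals, $K$ observations per individual, observational error variances $\sigma_1^2,\sigma_2^2>0$ and random-effects dispersions $u,v>0$ (as defined in the context). Suppose that $\sigma_1^2=\sigma_2^2$ and $u\neq v$. Then the D-optimal allocation rate to the first group for the prediction of the individual response parameters $\boldsymbol{\alpha}=(\alpha_1,\dots,\alpha_N)^\top$, i.e. the value of $w\in(0,1)$ minimizing the D-criterion $\Phi_{D,\alpha}(w)$, is $$w^*_{D,\alpha}=\frac{1}{2a}\left(a+2-\sqrt{a^2+4}\right),\qquad\text{where}\qquad a=N\log\left(\frac{Kv+1}{Ku+1}\right).$$
   Context: Model. There are $N=n_1+n_2$ individuals ($N$ fixed, $n_1,n_2\ge 1$); individuals $i=1,\dots,n_1$ form group $G_1$ and individuals $i=n_1+1,\dots,N$ form group $G_2$. The observations are $Y_{1ik}=\mu_{1i}+\varepsilon_{1ik}$ for $i=1,\dots,n_1$ and $Y_{2ik}=\mu_{2i}+\varepsilon_{2ik}$ for $i=n_1+1,\dots,N$, with $k=1,\dots,K$. The errors have mean zero and variances $\mathrm{var}(\varepsilon_{1ik})=\sigma_1^2$, $\mathrm{var}(\varepsilon_{2ik})=\sigma_2^2$. For every $i=1,\dots,N$ (in either group) both individual parameters are defined: $\boldsymbol{\theta}_i=(\mu_{1i},\mu_{2i})^\top$ is a random vector with unknown mean $(\mu_1,\mu_2)^\top$ and covariance matrix $\mathrm{diag}(\sigma_1^2u,\sigma_2^2v)$, with $u,v>0$ given. All $\boldsymbol{\theta}_i$ and all observational errors are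 mutually uncorrelated. The individual contrasts are $\alpha_i=\mu_{1i}-\mu_{2i}$, $i=1,\dots,N$, and $\hat{\boldsymbol{\alpha}}=(\hat\alpha_1,\dots,\hat\alpha_N)^\top$ is the vector of their best linear unbiased predictors. D-criterion. For an exact design $(n_1,n_2)$ the D-criterion for prediction is $\log\det\mathrm{Cov}(\hat{\boldsymbol{\alpha}}-\boldsymbol{\alpha})$, where $\log$ is the natural logarithm. It is extended to approximate designs, given by an allocation rate $w\in(0,1)$ to the first group (corresponding to $w=n_1/N$, $1-w=n_2/N$), by rewriting it in terms of $w$. In the case $\sigma_1^2=\sigma_2^2=\sigma^2$ this gives $$\Phi_{D,\alpha}(w)=b+wN\log\left(\frac{Kv+1}{Ku+1}\right)-\log\bigl(w(1-w)\bigr),\qquad 0<w<1,$$ where $b$ is a constant that does not depend on $w$ (it depends only on $N,K,u,v,\sigma^2$). *)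

theory Defs
  imports "HOL-Probability.Probability" "Jordan_Normal_Form.Determinant"
begin

definition cov :: "'a measure \<Rightarrow> ('a \<Rightarrow> real) \<Rightarrow> ('a \<Rightarrow> real) \<Rightarrow> real" where
  "cov M X Y = (\<integral>\<omega>. (X \<omega> - integral\<^sup>L M X) * (Y \<omega> - integral\<^sup>L M Y) \<partial>M)"

definition square_integrable :: "'a measure \<Rightarrow> ('a \<Rightarrow> real) \<Rightarrow> bool" where
  "square_integrable M X \<longleftrightarrow> X \<in> borel_measurable M \<and> integrable M (\<lambda>\<omega>. (X \<omega>)\<^sup>2)"

text \<open>The unknown population mean \<open>m = (\<mu>\<^sub>1, \<mu>\<^sub>2)\<close> indexes a family of probability measures
  \<open>P m\<close>.  The parameters \<open>s1\<close>, \<open>s2\<close> are the error variances (not the standard deviations).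
  Individual \<open>i\<close> belongs to the first group if \<open>1 \<le> i \<le> n1\<close> and to the second if
  \<open>n1 < i \<le> n1 + n2\<close>.  Each individual is observed in one group only, so a single family
  \<open>eps i k\<close> carries the errors of both groups, while \<open>mu1 i\<close> and \<open>mu2 i\<close> exist for every
  individual.\<close>

locale two_group_rcr =
  fixes P :: "real \<times> real \<Rightarrow> 'a measure"
    and n1 n2 K :: nat
    and s1 s2 u v :: real
    and mu1 mu2 :: "nat \<Rightarrow> 'a \<Rightarrow> real"
    and eps :: "nat \<Rightarrow> nat \<Rightarrow> 'a \<Rightarrow> real"
  assumes sizes: "1 \<le> n1" "1 \<le> n2" "1 \<le> K"
    and dispersions: "0 < s1" "0 < s2" "0 < u" "0 < v"
    and prob: "prob_space (P m)"
    and square_integrable_mu1: "i \<in> {1..n1 + n2} \<Longrightarrow> square_integrable (P m) (mu1 i)"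
    and square_integrable_mu2: "i \<in> {1..n1 + n2} \<Longrightarrow> square_integrable (P m) (mu2 i)"
    and square_integrable_eps:
      "\<lbrakk>i \<in> {1..n1 + n2}; k \<in> {1..K}\<rbrakk> \<Longrightarrow> square_integrable (P m) (eps i k)"
    and mean_mu1: "i \<in> {1..n1 + n2} \<Longrightarrow> integral\<^sup>L (P m) (mu1 i) = fst m"
    and mean_mu2: "i \<in> {1..n1 + n2} \<Longrightarrow> integral\<^sup>L (P m) (mu2 i) = snd m"
    and mean_eps: "\<lbrakk>i \<in> {1..n1 + n2}; k \<in> {1..K}\<rbrakk> \<Longrightarrow> integral\<^sup>L (P m) (eps i k) = 0"
    and cov_mu1: "\<lbrakk>i \<in> {1..n1 + n2}; j \<in> {1..n1 + n2}\<rbrakk> \<Longrightarrow>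
      cov (P m) (mu1 i) (mu1 j) = (if i = j then s1 * u else 0)"
    and cov_mu2: "\<lbrakk>i \<in> {1..n1 + n2}; j \<in> {1..n1 + n2}\<rbrakk> \<Longrightarrow>
      cov (P m) (mu2 i) (mu2 j) = (if i = j then s2 * v else 0)"
    and cov_mu1_mu2: "\<lbrakk>i \<in> {1..n1 + n2}; j \<in> {1..n1 + n2}\<rbrakk> \<Longrightarrow>
      cov (P m) (mu1 i) (mu2 j) = 0"
    and cov_eps: "\<lbrakk>i \<in> {1..n1 + n2}; k \<in> {1..K}; j \<in> {1..n1 + n2}; l \<in> {1..K}\<rbrakk> \<Longrightarrow>
      cov (P m) (eps i k) (eps j l)
        = (if i = j \<and> k = l then (if i \<le> n1 then s1 else s2) else 0)"
    and cov_mu1_eps: "\<lbrakk>i \<in> {1..n1 + n2}; j \<in> {1..n1 + n2}; l \<in> {1..K}\<rbrakk> \<Longrightarrow>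
      cov (P m) (mu1 i) (eps j l) = 0"
    and cov_mu2_eps: "\<lbrakk>i \<in> {1..n1 + n2}; j \<in> {1..n1 + n2}; l \<in> {1..K}\<rbrakk> \<Longrightarrow>
      cov (P m) (mu2 i) (eps j l) = 0"
begin

definition obs :: "nat \<Rightarrow> nat \<Rightarrow> 'a \<Rightarrow> real" where
  "obs i k \<omega> = (if i \<le> n1 then mu1 i \<omega> else mu2 i \<omega>) + eps i k \<omega>"

definition contrast :: "nat \<Rightarrow> 'a \<Rightarrow> real" where
  "contrast i \<omega> = mu1 i \<omega> - mu2 i \<omega>"

definition linear_predictor :: "('a \<Rightarrow> real) \<Rightarrow> bool" where
  "linear_predictor Z \<longleftrightarrow>
    (\<exists>c. Z = (\<lambda>\<omega>. \<Sum>i = 1..n1 + n2. \<Sum>k = 1..K. c i k * obs i k \<omega>))"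

definition unbiased_for :: "('a \<Rightarrow> real) \<Rightarrow> ('a \<Rightarrow> real) \<Rightarrow> bool" where
  "unbiased_for T Z \<longleftrightarrow> (\<forall>m. integral\<^sup>L (P m) Z = integral\<^sup>L (P m) T)"

definition is_blup :: "('a \<Rightarrow> real) \<Rightarrow> ('a \<Rightarrow> real) \<Rightarrow> bool" where
  "is_blup T Z \<longleftrightarrow> linear_predictor Z \<and> unbiased_for T Z \<and>
    (\<forall>Z'. linear_predictor Z' \<and> unbiased_for T Z' \<longrightarrow>
      (\<forall>m. (\<integral>\<omega>. (Z \<omega> - T \<omega>)\<^sup>2 \<partial>P m) \<le> (\<integral>\<omega>. (Z' \<omega> - T \<omega>)\<^sup>2 \<partial>P m)))"

text \<open>A best linear unbiased predictor is only determined up to null sets, which do not affect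
  the covariances below; hence a choice is harmless.\<close>

definition blup :: "('a \<Rightarrow> real) \<Rightarrow> 'a \<Rightarrow> real" where
  "blup T = (SOME Z. is_blup T Z)"

definition prediction_error :: "nat \<Rightarrow> 'a \<Rightarrow> real" where
  "prediction_error i \<omega> = blup (contrast i) \<omega> - contrast i \<omega>"

text \<open>Matrix indices start at 0, individuals are numbered from 1.\<close>

definition prediction_error_cov :: "real \<times> real \<Rightarrow> real mat" where
  "prediction_error_cov m = mat (n1 + n2) (n1 + n2)
    (\<lambda>(i, j). cov (P m) (prediction_error (Suc i)) (prediction_error (Suc j)))"

definition D_criterion :: "real \<times> real \<Rightarrow> real" where
  "D_criterion m = ln (Determinant.det (prediction_error_cov m))"

end

text \<open>The D-criterion for approximate designs under equal error variances, as a function of the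
  allocation rate \<open>w\<close> to the first group, up to the additive constant \<open>b\<close>.\<close>

definition D_criterion_approx :: "nat \<Rightarrow> nat \<Rightarrow> real \<Rightarrow> real \<Rightarrow> real \<Rightarrow> real \<Rightarrow> real" where
  "D_criterion_approx N K u v b w =
    b + w * real N * ln ((real K * v + 1) / (real K * u + 1)) - ln (w * (1 - w))"

end

theory Submission
  imports Defs
begin

text \<open>
  An unbiased linear predictor is best if its error is uncorrelated with every linear statistic
  whose weights sum to zero in each group; this gives the predictors explicitly: shrink the
  individual mean towards the group mean for the response observed, and use the other group's mean
  for the response not observed.  Under equal variances \<open>s\<close>, the error covariance matrix is diagonal
  plus a matrix of rank two, with \<open>s t / U\<close> and \<open>s t / V\<close> on the diagonal, where \<open>U = K u + 1\<close>,
  \<open>V = K v + 1\<close>, \<open>t = u + v + K u v\<close>.  As \<open>U V - 1 = K t\<close>, Sylvester's determinant identity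
  collapses the correction factor to \<open>U V / (K t w (1 - w))\<close>.  Finally the optimal rate \<open>w0\<close>
  satisfies \<open>a = 1 / w0 - 1 / (1 - w0)\<close>, so that the excess of the criterion at \<open>w\<close> is
  \<open>g (w / w0) + g ((1 - w) / (1 - w0))\<close> with \<open>g x = x - 1 - ln x \<ge> 0\<close>.
\<close>

subsection \<open>Covariances\<close>

lemma square_integrable_add:
  assumes "square_integrable M X" "square_integrable M Y"
  shows "square_integrable M (\<lambda>\<omega>. X \<omega> + Y \<omega>)"
proof -
  have [measurable]: "X \<in> borel_measurable M" "Y \<in> borel_measurable M"
    using assms by (auto simp: square_integrable_def)
  have "integrable M (\<lambda>\<omega>. 2 * (X \<omega>)\<^sup>2 + 2 * (Y \<omega>)\<^sup>2)"
    using assms by (simp add: square_integrable_def)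
  then have "integrable M (\<lambda>\<omega>. (X \<omega> + Y \<omega>)\<^sup>2)"
  proof (rule Bochner_Integration.integrable_bound)
    have "(x + y)\<^sup>2 \<le> 2 * x\<^sup>2 + 2 * y\<^sup>2" for x y :: real
      using zero_le_power2[of "x - y"] by (simp add: power2_sum power2_diff)
    then show "AE \<omega> in M. norm ((X \<omega> + Y \<omega>)\<^sup>2) \<le> norm (2 * (X \<omega>)\<^sup>2 + 2 * (Y \<omega>)\<^sup>2)"
      by simp
  qed measurable
  then show ?thesis by (simp add: square_integrable_def)
qed

lemma square_integrable_zero: "square_integrable M (\<lambda>_. 0)"
  unfolding square_integrable_def by simp

lemma square_integrable_cmult:
  assumes "square_integrable M X"
  shows "square_integrable M (\<lambda>\<omega>. c * X \<omega>)"
proof -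
  have X: "X \<in> borel_measurable M" "integrable M (\<lambda>\<omega>. (X \<omega>)\<^sup>2)"
    using assms by (simp_all only: square_integrable_def)
  have "(\<lambda>\<omega>. c * X \<omega>) \<in> borel_measurable M"
    by (rule borel_measurable_times[OF borel_measurable_const X(1)])
  moreover have "integrable M (\<lambda>\<omega>. c\<^sup>2 * (X \<omega>)\<^sup>2)"
    by (rule Bochner_Integration.integrable_mult_right[OF X(2)])
  ultimately show ?thesis
    by (simp only: square_integrable_def power_mult_distrib)
qed

lemma square_integrable_diff:
  assumes "square_integrable M X" "square_integrable M Y"
  shows "square_integrable M (\<lambda>\<omega>. X \<omega> - Y \<omega>)"
proof -
  have "(\<lambda>\<omega>. X \<omega> - Y \<omega>) = (\<lambda>\<omega>. X \<omega> + -1 * Y \<omega>)"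
    by auto
  with square_integrable_add[OF assms(1) square_integrable_cmult[OF assms(2), of "-1"]]
  show ?thesis by (simp only:)
qed

lemma square_integrable_sum:
  assumes "\<And>i. i \<in> I \<Longrightarrow> square_integrable M (X i)"
  shows "square_integrable M (\<lambda>\<omega>. \<Sum>i\<in>I. X i \<omega>)"
  using assms
proof (induction I rule: infinite_finite_induct)
  case (insert i I)
  have "square_integrable M (\<lambda>\<omega>. X i \<omega> + (\<Sum>i\<in>I. X i \<omega>))"
    by (rule square_integrable_add[OF insert.prems insert.IH[OF insert.prems]]) simp_all
  with insert.hyps show ?case by (simp only: sum.insert not_False_eq_True)
qed (simp_all only: sum.infinite sum.empty not_False_eq_True square_integrable_zero)

text \<open>Polarisation: the product is half of the square of the sum minus both squares, and all
  three squares are integrable.\<close>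

lemma integrable_mult_square_integrable:
  assumes "square_integrable M X" "square_integrable M Y"
  shows "integrable M (\<lambda>\<omega>. X \<omega> * Y \<omega>)"
proof -
  have "integrable M (\<lambda>\<omega>. ((X \<omega> + Y \<omega>)\<^sup>2 - (X \<omega>)\<^sup>2 - (Y \<omega>)\<^sup>2) / 2)"
    using assms square_integrable_add[OF assms] by (simp add: square_integrable_def)
  then show ?thesis by (simp add: power2_sum)
qed

lemma cov_commute: "cov M X Y = cov M Y X"
  by (simp add: cov_def mult.commute)

section \<open>Bilinearity of the covariance\<close>

context prob_space
begin

lemma integrable_if_square_integrable:
  assumes "square_integrable M X"
  shows "integrable M X"
  using assms unfolding square_integrable_def by (elim conjE) (rule square_integrable_imp_integrable)

lemma square_integrable_centred:
  assumes "square_integrable M X"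
  shows "square_integrable M (\<lambda>\<omega>. X \<omega> - c)"
proof (rule square_integrable_diff[OF assms])
  show "square_integrable M (\<lambda>_. c)"
    unfolding square_integrable_def by simp
qed

lemma cov_add_left:
  assumes "square_integrable M X" "square_integrable M Y" "square_integrable M Z"
  shows "cov M (\<lambda>\<omega>. X \<omega> + Y \<omega>) Z = cov M X Z + cov M Y Z"
proof -
  have "expectation (\<lambda>\<omega>. X \<omega> + Y \<omega>) = expectation X + expectation Y"
    using assms by (intro Bochner_Integration.integral_add integrable_if_square_integrable)
  then have "cov M (\<lambda>\<omega>. X \<omega> + Y \<omega>) Z = (\<integral>\<omega>. (X \<omega> - expectation X) * (Z \<omega> - expectation Z)
      + (Y \<omega> - expectation Y) * (Z \<omega> - expectation Z) \<partial>M)"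
    unfolding cov_def by (intro Bochner_Integration.integral_cong refl) (simp only: algebra_simps)
  also have "\<dots> = cov M X Z + cov M Y Z"
    unfolding cov_def using assms
    by (intro Bochner_Integration.integral_add integrable_mult_square_integrable
        square_integrable_centred)
  finally show ?thesis .
qed

lemma cov_cmult_left: "cov M (\<lambda>\<omega>. c * X \<omega>) Y = c * cov M X Y"
proof -
  have "(\<lambda>\<omega>. (c * X \<omega> - c * expectation X) * (Y \<omega> - expectation Y))
      = (\<lambda>\<omega>. c * ((X \<omega> - expectation X) * (Y \<omega> - expectation Y)))"
    by (rule ext) (simp only: right_diff_distrib[symmetric] mult.assoc)
  \<comment> \<open>\<open>integral_mult_right_zero\<close> also covers a non-integrable factor,
    where both sides are 0 by the default value of the integral.\<close>
  then show ?thesis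
    unfolding cov_def by (simp only: Bochner_Integration.integral_mult_right_zero)
qed

lemma cov_diff_left:
  assumes "square_integrable M X" "square_integrable M Y" "square_integrable M Z"
  shows "cov M (\<lambda>\<omega>. X \<omega> - Y \<omega>) Z = cov M X Z - cov M Y Z"
proof -
  have "cov M (\<lambda>\<omega>. X \<omega> - Y \<omega>) Z = cov M (\<lambda>\<omega>. X \<omega> + -1 * Y \<omega>) Z"
    by (rule arg_cong[where f = "\<lambda>W. cov M W Z"]) auto
  also have "\<dots> = cov M X Z + -1 * cov M Y Z"
    by (simp only: cov_add_left[OF assms(1) square_integrable_cmult[OF assms(2)] assms(3)]
        cov_cmult_left)
  finally show ?thesis by linarith
qed

lemma cov_sum_left:
  assumes "\<And>i. i \<in> I \<Longrightarrow> square_integrable M (X i)" "square_integrable M Z"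
  shows "cov M (\<lambda>\<omega>. \<Sum>i\<in>I. X i \<omega>) Z = (\<Sum>i\<in>I. cov M (X i) Z)"
proof -
  have zero: "cov M (\<lambda>_. 0) Z = 0"
    by (simp add: cov_def)
  show ?thesis
    using assms(1)
  proof (induction I rule: infinite_finite_induct)
    case (insert i I)
    have "cov M (\<lambda>\<omega>. X i \<omega> + (\<Sum>i\<in>I. X i \<omega>)) Z
        = cov M (X i) Z + cov M (\<lambda>\<omega>. \<Sum>i\<in>I. X i \<omega>) Z"
      by (rule cov_add_left[OF insert.prems square_integrable_sum[OF insert.prems] assms(2)]) simp_all
    moreover have "cov M (\<lambda>\<omega>. \<Sum>i\<in>I. X i \<omega>) Z = (\<Sum>i\<in>I. cov M (X i) Z)"
      by (rule insert.IH, rule insert.prems) simp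
    ultimately show ?case
      using insert.hyps by (simp only: sum.insert not_False_eq_True)
  qed (simp_all only: sum.infinite sum.empty not_False_eq_True zero)
qed

lemma cov_add_right:
  assumes "square_integrable M X" "square_integrable M Y" "square_integrable M Z"
  shows "cov M Z (\<lambda>\<omega>. X \<omega> + Y \<omega>) = cov M Z X + cov M Z Y"
  using cov_add_left[OF assms] cov_commute[of M Z X] cov_commute[of M Z Y]
    cov_commute[of M Z "\<lambda>\<omega>. X \<omega> + Y \<omega>"] by linarith

lemma cov_diff_right:
  assumes "square_integrable M X" "square_integrable M Y" "square_integrable M Z"
  shows "cov M Z (\<lambda>\<omega>. X \<omega> - Y \<omega>) = cov M Z X - cov M Z Y"
  using cov_diff_left[OF assms] cov_commute[of M Z X] cov_commute[of M Z Y]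
    cov_commute[of M Z "\<lambda>\<omega>. X \<omega> - Y \<omega>"] by linarith

lemma integral_square_eq_cov:
  assumes "expectation X = 0"
  shows "(\<integral>\<omega>. (X \<omega>)\<^sup>2 \<partial>M) = cov M X X"
  using assms by (simp add: cov_def power2_eq_square)

end

subsection \<open>Best linear unbiased prediction\<close>

context two_group_rcr
begin

text \<open>Makes the weights inside \<open>linear_predictor\<close> explicit, so that predictors
  can be compared through their weights.\<close>

definition linear_statistic :: "(nat \<Rightarrow> nat \<Rightarrow> real) \<Rightarrow> 'a \<Rightarrow> real" where
  "linear_statistic c \<omega> = (\<Sum>i = 1..n1 + n2. \<Sum>k = 1..K. c i k * obs i k \<omega>)"

lemma linear_predictor_iff: "linear_predictor Z \<longleftrightarrow> (\<exists>c. Z = linear_statistic c)"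
  unfolding linear_predictor_def linear_statistic_def[abs_def] ..

text \<open>Variance of the one response that is observed for individual \<open>i\<close>; all
  \<open>K\<close> observations of \<open>i\<close> share it.\<close>

definition response_var :: "nat \<Rightarrow> real" where
  "response_var i = (if i \<le> n1 then s1 * u else s2 * v)"

definition error_var :: "nat \<Rightarrow> real" where
  "error_var i = (if i \<le> n1 then s1 else s2)"

text \<open>Covariance of a contrast with an observation of the same individual; the sign in the
  second group is that of \<open>mu2\<close> in the contrast.\<close>

definition contrast_obs_cov :: "nat \<Rightarrow> real" where
  "contrast_obs_cov i = (if i \<le> n1 then s1 * u else - (s2 * v))"

section \<open>First and second moments of observations, contrasts and linear statistics\<close>

lemma square_integrable_obs:
  assumes "i \<in> {1..n1 + n2}" "k \<in> {1..K}"
  shows "square_integrable (P m) (obs i k)"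
  using square_integrable_add[OF square_integrable_mu1 square_integrable_eps]
    square_integrable_add[OF square_integrable_mu2 square_integrable_eps] assms
  by (cases "i \<le> n1") (simp_all add: obs_def[abs_def])

lemma square_integrable_contrast:
  "i \<in> {1..n1 + n2} \<Longrightarrow> square_integrable (P m) (contrast i)"
  unfolding contrast_def[abs_def]
  by (intro square_integrable_diff square_integrable_mu1 square_integrable_mu2)

lemma square_integrable_linear_statistic: "square_integrable (P m) (linear_statistic c)"
  unfolding linear_statistic_def[abs_def]
  by (intro square_integrable_sum square_integrable_cmult square_integrable_obs)

lemma expectation_obs:
  assumes "i \<in> {1..n1 + n2}" "k \<in> {1..K}"
  shows "integral\<^sup>L (P m) (obs i k) = (if i \<le> n1 then fst m else snd m)"
proof -
  interpret prob_space "P m" by (rule prob)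
  show ?thesis
    using assms mean_mu1[of i m] mean_mu2[of i m] mean_eps[of i k m]
    by (cases "i \<le> n1")
      (simp_all add: obs_def[abs_def] integrable_if_square_integrable square_integrable_mu1
        square_integrable_mu2 square_integrable_eps)
qed

lemma expectation_contrast:
  assumes "i \<in> {1..n1 + n2}"
  shows "integral\<^sup>L (P m) (contrast i) = fst m - snd m"
proof -
  interpret prob_space "P m" by (rule prob)
  show ?thesis
    using assms mean_mu1[of i m] mean_mu2[of i m]
    by (simp add: contrast_def[abs_def] integrable_if_square_integrable square_integrable_mu1
        square_integrable_mu2)
qed

lemma sum_individuals:
  "(\<Sum>i = 1..n1 + n2. f i) = (\<Sum>i = 1..n1. f i) + (\<Sum>i = n1 + 1..n1 + n2. f i)"
  by (rule sum.ub_add_nat) simp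

text \<open>The mean of an observation depends only on its group, so only the two group totals of
  the weights survive.\<close>

lemma expectation_linear_statistic:
  "integral\<^sup>L (P m) (linear_statistic c)
    = fst m * (\<Sum>i = 1..n1. \<Sum>k = 1..K. c i k) + snd m * (\<Sum>i = n1 + 1..n1 + n2. \<Sum>k = 1..K. c i k)"
proof -
  interpret prob_space "P m" by (rule prob)
  have int: "integrable (P m) (\<lambda>\<omega>. c i k * obs i k \<omega>)" if "i \<in> {1..n1 + n2}" "k \<in> {1..K}" for i k
    by (intro integrable_if_square_integrable square_integrable_cmult square_integrable_obs that)
  have "integral\<^sup>L (P m) (linear_statistic c)
      = (\<Sum>i = 1..n1 + n2. integral\<^sup>L (P m) (\<lambda>\<omega>. \<Sum>k = 1..K. c i k * obs i k \<omega>))"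
    unfolding linear_statistic_def[abs_def]
    by (intro Bochner_Integration.integral_sum Bochner_Integration.integrable_sum int)
  also have "\<dots> = (\<Sum>i = 1..n1 + n2. \<Sum>k = 1..K. integral\<^sup>L (P m) (\<lambda>\<omega>. c i k * obs i k \<omega>))"
    by (intro sum.cong refl Bochner_Integration.integral_sum int)
  also have "\<dots> = (\<Sum>i = 1..n1 + n2. \<Sum>k = 1..K. c i k * integral\<^sup>L (P m) (obs i k))"
    by (simp only: Bochner_Integration.integral_mult_right_zero)
  also have "\<dots> = (\<Sum>i = 1..n1 + n2. \<Sum>k = 1..K. c i k * (if i \<le> n1 then fst m else snd m))"
    by (intro sum.cong refl) (simp add: expectation_obs)
  also have "\<dots> = fst m * (\<Sum>i = 1..n1. \<Sum>k = 1..K. c i k)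
      + snd m * (\<Sum>i = n1 + 1..n1 + n2. \<Sum>k = 1..K. c i k)"
    unfolding sum_individuals sum_distrib_left
    by (intro arg_cong2[of _ _ _ _ "(+)"] sum.cong refl) auto
  finally show ?thesis .
qed

text \<open>Unbiasedness is required for every population mean \<open>m\<close>, so two linear forms
  in \<open>m\<close> must agree; the unit vectors extract their coefficients.\<close>

lemma unbiased_for_contrast_iff:
  assumes "i \<in> {1..n1 + n2}"
  shows "unbiased_for (contrast i) (linear_statistic c) \<longleftrightarrow>
    (\<Sum>j = 1..n1. \<Sum>k = 1..K. c j k) = 1 \<and> (\<Sum>j = n1 + 1..n1 + n2. \<Sum>k = 1..K. c j k) = -1"
    (is "_ \<longleftrightarrow> ?A = 1 \<and> ?B = -1")
proof -
  have "(\<forall>m :: real \<times> real. fst m * ?A + snd m * ?B = fst m - snd m) \<longleftrightarrow> ?A = 1 \<and> ?B = -1"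
  proof
    assume *: "\<forall>m :: real \<times> real. fst m * ?A + snd m * ?B = fst m - snd m"
    show "?A = 1 \<and> ?B = -1"
      using *[rule_format, of "(1, 0)"] *[rule_format, of "(0, 1)"] by simp
  qed simp
  then show ?thesis
    unfolding unbiased_for_def expectation_linear_statistic expectation_contrast[OF assms] .
qed

lemma cov_contrast_obs:
  assumes "i \<in> {1..n1 + n2}" "j \<in> {1..n1 + n2}" "l \<in> {1..K}"
  shows "cov (P m) (contrast i) (obs j l) = (if i = j then contrast_obs_cov j else 0)"
proof -
  interpret prob_space "P m" by (rule prob)
  show ?thesis
    using assms
    by (cases "j \<le> n1")
      (simp_all add: obs_def[abs_def] contrast_def[abs_def] contrast_obs_cov_def cov_diff_left
        cov_add_right square_integrable_add square_integrable_mu1 square_integrable_mu2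
        square_integrable_eps cov_mu1 cov_mu2 cov_mu1_mu2 cov_mu1_eps cov_mu2_eps
        cov_commute[of _ "mu2 i" "mu1 j"])
qed

lemma cov_contrast_contrast:
  assumes "i \<in> {1..n1 + n2}" "j \<in> {1..n1 + n2}"
  shows "cov (P m) (contrast i) (contrast j) = (if i = j then s1 * u + s2 * v else 0)"
proof -
  interpret prob_space "P m" by (rule prob)
  show ?thesis
    using assms
    by (simp add: contrast_def[abs_def] cov_diff_left cov_diff_right square_integrable_diff
        square_integrable_mu1 square_integrable_mu2 cov_mu1 cov_mu2 cov_mu1_mu2
        cov_commute[of _ "mu2 i" "mu1 j"])
qed

lemma cov_obs_obs:
  assumes "i \<in> {1..n1 + n2}" "k \<in> {1..K}" "j \<in> {1..n1 + n2}" "l \<in> {1..K}"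
  shows "cov (P m) (obs i k) (obs j l)
    = (if i = j then response_var j + (if k = l then error_var j else 0) else 0)"
proof -
  interpret prob_space "P m" by (rule prob)
  show ?thesis
    using assms
    by (cases "i \<le> n1"; cases "j \<le> n1")
      (simp_all add: obs_def[abs_def] response_var_def error_var_def cov_add_left
        cov_add_right square_integrable_add square_integrable_mu1 square_integrable_mu2
        square_integrable_eps cov_mu1 cov_mu2 cov_mu1_mu2 cov_mu1_eps cov_mu2_eps cov_eps
        cov_commute[of _ "mu2 i" "mu1 j"] cov_commute[of _ "eps i k" "mu1 j"]
        cov_commute[of _ "eps i k" "mu2 j"])
qed

lemma cov_linear_statistic_left:
  assumes "square_integrable (P m) Z"
  shows "cov (P m) (linear_statistic c) Z
    = (\<Sum>i = 1..n1 + n2. \<Sum>k = 1..K. c i k * cov (P m) (obs i k) Z)"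
proof -
  interpret prob_space "P m" by (rule prob)
  have "cov (P m) (linear_statistic c) Z
      = (\<Sum>i = 1..n1 + n2. cov (P m) (\<lambda>\<omega>. \<Sum>k = 1..K. c i k * obs i k \<omega>) Z)"
    unfolding linear_statistic_def[abs_def] using assms
    by (intro cov_sum_left square_integrable_sum square_integrable_cmult square_integrable_obs)
  also have "\<dots> = (\<Sum>i = 1..n1 + n2. \<Sum>k = 1..K. cov (P m) (\<lambda>\<omega>. c i k * obs i k \<omega>) Z)"
    using assms
    by (intro sum.cong refl cov_sum_left square_integrable_cmult square_integrable_obs)
  finally show ?thesis by (simp only: cov_cmult_left)
qed

lemma cov_linear_statistic_obs:
  assumes "j \<in> {1..n1 + n2}" "l \<in> {1..K}"
  shows "cov (P m) (linear_statistic c) (obs j l)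
    = response_var j * (\<Sum>k = 1..K. c j k) + error_var j * c j l"
proof -
  have "cov (P m) (linear_statistic c) (obs j l) = (\<Sum>i = 1..n1 + n2. \<Sum>k = 1..K.
      c i k * (if i = j then response_var j + (if k = l then error_var j else 0) else 0))"
    using assms
    by (subst cov_linear_statistic_left[OF square_integrable_obs]) (simp_all add: cov_obs_obs)
  also have "\<dots> = (\<Sum>i = 1..n1 + n2. if i = j then (\<Sum>k = 1..K.
      c i k * response_var j + (if k = l then c i k * error_var j else 0)) else 0)"
    by (intro sum.cong refl) (auto simp: algebra_simps intro!: sum.cong)
  also have "\<dots> = (\<Sum>k = 1..K.
      c j k * response_var j + (if k = l then c j k * error_var j else 0))"
    using assms by simp
  also have "\<dots> = response_var j * (\<Sum>k = 1..K. c j k) + error_var j * c j l"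
    using assms by (simp add: sum.distrib sum_distrib_right[symmetric] mult.commute)
  finally show ?thesis .
qed

lemma cov_linear_statistic_contrast:
  assumes "j \<in> {1..n1 + n2}"
  shows "cov (P m) (linear_statistic c) (contrast j) = contrast_obs_cov j * (\<Sum>k = 1..K. c j k)"
proof -
  have "cov (P m) (linear_statistic c) (contrast j) = (\<Sum>i = 1..n1 + n2. \<Sum>k = 1..K.
      c i k * (if j = i then contrast_obs_cov i else 0))"
    using assms
    by (subst cov_linear_statistic_left[OF square_integrable_contrast])
      (simp_all add: cov_contrast_obs cov_commute[of _ "obs _ _"])
  also have "\<dots> = (\<Sum>i = 1..n1 + n2. if j = i then (\<Sum>k = 1..K. c i k * contrast_obs_cov i) else 0)"
    by (intro sum.cong refl) (auto simp: algebra_simps intro!: sum.cong)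
  also have "\<dots> = contrast_obs_cov j * (\<Sum>k = 1..K. c j k)"
    using assms by (simp add: sum_distrib_right[symmetric] mult.commute)
  finally show ?thesis .
qed

text \<open>Distinct individuals are uncorrelated, so the quadratic form splits into individuals.
  Within one of them the shared response sees the total weight, while the errors see the single
  weights.\<close>

lemma var_linear_statistic:
  "cov (P m) (linear_statistic c) (linear_statistic c)
    = (\<Sum>i = 1..n1 + n2. response_var i * (\<Sum>k = 1..K. c i k)\<^sup>2 + error_var i * (\<Sum>k = 1..K. (c i k)\<^sup>2))"
  unfolding cov_linear_statistic_left[OF square_integrable_linear_statistic]
proof (intro sum.cong refl)
  fix i assume i: "i \<in> {1..n1 + n2}"
  have "(\<Sum>k = 1..K. c i k * cov (P m) (obs i k) (linear_statistic c))
      = (\<Sum>k = 1..K. c i k * (response_var i * (\<Sum>k = 1..K. c i k) + error_var i * c i k))"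
    using i by (intro sum.cong refl)
      (simp only: cov_commute[of _ "obs _ _"] cov_linear_statistic_obs)
  also have "\<dots> = response_var i * (\<Sum>k = 1..K. c i k)\<^sup>2 + error_var i * (\<Sum>k = 1..K. (c i k)\<^sup>2)"
    by (simp add: sum.distrib sum_distrib_left sum_distrib_right power2_eq_square algebra_simps)
  finally show "(\<Sum>k = 1..K. c i k * cov (P m) (obs i k) (linear_statistic c))
      = response_var i * (\<Sum>k = 1..K. c i k)\<^sup>2 + error_var i * (\<Sum>k = 1..K. (c i k)\<^sup>2)" .
qed

text \<open>Positive error variances make the covariance matrix of the observations positive
  definite. This yields the uniqueness of the best weights.\<close>

lemma var_linear_statistic_nonpos_imp_zero:
  assumes "cov (P m) (linear_statistic c) (linear_statistic c) \<le> 0"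
    and "i \<in> {1..n1 + n2}" "k \<in> {1..K}"
  shows "c i k = 0"
proof -
  have nonneg: "0 \<le> response_var j * (\<Sum>k = 1..K. c j k)\<^sup>2" "0 \<le> error_var j * (\<Sum>k = 1..K. (c j k)\<^sup>2)" for j
    using dispersions by (simp_all add: response_var_def error_var_def sum_nonneg)
  have "0 < error_var i"
    using dispersions by (simp add: error_var_def)
  then have "error_var i * (c i k)\<^sup>2 \<le> error_var i * (\<Sum>k = 1..K. (c i k)\<^sup>2)"
    using assms(3) by (intro mult_left_mono member_le_sum) auto
  also have "\<dots> \<le> response_var i * (\<Sum>k = 1..K. c i k)\<^sup>2 + error_var i * (\<Sum>k = 1..K. (c i k)\<^sup>2)"
    using nonneg[of i] by simp
  also have "\<dots> \<le> cov (P m) (linear_statistic c) (linear_statistic c)"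
    unfolding var_linear_statistic using assms(2) nonneg by (intro member_le_sum add_nonneg_nonneg) auto
  finally have "error_var i * (c i k)\<^sup>2 \<le> 0" using assms(1) by simp
  then show ?thesis
    using \<open>0 < error_var i\<close> by (simp add: mult_le_0_iff)
qed

section \<open>The explicit predictor and its optimality\<close>

text \<open>Weight of the mean of the \<open>K\<close> observations of \<open>j\<close> when the
  contrast of \<open>i\<close> is predicted; \<open>predictor\<close> divides it by \<open>K\<close>
  to weight single observations. The shrinkage factor \<open>K * u / (K * u + 1)\<close> goes to the
  own mean, its complement to the group mean; likewise with \<open>v\<close>.\<close>

definition blup_weight :: "nat \<Rightarrow> nat \<Rightarrow> real" where
  "blup_weight i j =
    (if i \<le> n1 then
      if j \<le> n1 then 1 / (n1 * (K * u + 1)) + (if i = j then K * u / (K * u + 1) else 0)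
      else - 1 / n2
    else
      if j \<le> n1 then 1 / n1
      else - (1 / (n2 * (K * v + 1)) + (if i = j then K * v / (K * v + 1) else 0)))"

abbreviation "predictor i \<equiv> linear_statistic (\<lambda>j k. blup_weight i j / K)"

text \<open>In \<open>j\<close> there is one value per group: up to a constant factor, these are the
  Lagrange multipliers of the two unbiasedness constraints.\<close>

definition error_obs_cov :: "nat \<Rightarrow> nat \<Rightarrow> real" where
  "error_obs_cov i j =
    (if i \<le> n1 then if j \<le> n1 then s1 / (K * n1) else - (s2 * (K * v + 1) / (K * n2))
     else if j \<le> n1 then s1 * (K * u + 1) / (K * n1) else - (s2 / (K * n2)))"

lemma sum_blup_weight:
  assumes "i \<in> {1..n1 + n2}"
  shows "(\<Sum>j = 1..n1. blup_weight i j) = 1" "(\<Sum>j = n1 + 1..n1 + n2. blup_weight i j) = -1"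
proof -
  have pos: "0 < real K * u + 1" "0 < real K * v + 1" "real n1 \<noteq> 0" "real n2 \<noteq> 0"
    using sizes dispersions by (auto intro: add_nonneg_pos)
  show "(\<Sum>j = 1..n1. blup_weight i j) = 1"
  proof (cases "i \<le> n1")
    case True
    then have "(\<Sum>j = 1..n1. blup_weight i j)
        = (\<Sum>j = 1..n1. 1 / (n1 * (K * u + 1)) + (if i = j then K * u / (K * u + 1) else 0))"
      by (intro sum.cong) (auto simp: blup_weight_def)
    also have "\<dots> = 1 / (K * u + 1) + K * u / (K * u + 1)"
      using True assms pos by (simp add: sum.distrib)
    also have "\<dots> = 1"
      using pos by (simp add: add_divide_distrib[symmetric] add.commute)
    finally show ?thesis .
  next
    case False
    then have "(\<Sum>j = 1..n1. blup_weight i j) = (\<Sum>j = 1..n1. 1 / n1)"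
      by (intro sum.cong) (auto simp: blup_weight_def)
    then show ?thesis using pos by simp
  qed
  show "(\<Sum>j = n1 + 1..n1 + n2. blup_weight i j) = -1"
  proof (cases "i \<le> n1")
    case True
    then have "(\<Sum>j = n1 + 1..n1 + n2. blup_weight i j) = (\<Sum>j = n1 + 1..n1 + n2. - 1 / n2)"
      by (intro sum.cong) (auto simp: blup_weight_def)
    then show ?thesis using pos by simp
  next
    case False
    then have "(\<Sum>j = n1 + 1..n1 + n2. blup_weight i j)
        = (\<Sum>j = n1 + 1..n1 + n2. - (1 / (n2 * (K * v + 1)) + (if i = j then K * v / (K * v + 1) else 0)))"
      by (intro sum.cong) (auto simp: blup_weight_def)
    also have "\<dots> = - (1 / (K * v + 1) + K * v / (K * v + 1))"
      unfolding sum_negf using False assms pos by (simp add: sum.distrib)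
    also have "\<dots> = -1"
      using pos by (simp add: add_divide_distrib[symmetric] add.commute)
    finally show ?thesis .
  qed
qed

lemma sum_predictor_weights: "(\<Sum>k = 1..K. blup_weight i j / K) = blup_weight i j"
  using sizes by simp

lemma unbiased_predictor: "i \<in> {1..n1 + n2} \<Longrightarrow> unbiased_for (contrast i) (predictor i)"
  by (simp only: unbiased_for_contrast_iff sum_predictor_weights sum_blup_weight)

text \<open>The covariance depends on \<open>j\<close> only through its group, so the prediction error is
  uncorrelated with every linear statistic whose weights sum to zero in each group.\<close>

lemma cov_prediction_error_obs:
  assumes "i \<in> {1..n1 + n2}" "j \<in> {1..n1 + n2}" "l \<in> {1..K}"
  shows "cov (P m) (\<lambda>\<omega>. predictor i \<omega> - contrast i \<omega>) (obs j l) = error_obs_cov i j"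
proof -
  interpret prob_space "P m" by (rule prob)
  have pos: "real K * u + 1 \<noteq> 0" "real K * v + 1 \<noteq> 0" "real n1 \<noteq> 0" "real n2 \<noteq> 0" "real K \<noteq> 0"
    using sizes dispersions by (auto simp: add_nonneg_eq_0_iff)
  have "cov (P m) (\<lambda>\<omega>. predictor i \<omega> - contrast i \<omega>) (obs j l)
      = response_var j * blup_weight i j + error_var j * (blup_weight i j / K)
        - (if i = j then contrast_obs_cov j else 0)"
    using assms
    by (simp only: cov_diff_left square_integrable_linear_statistic square_integrable_contrast
        square_integrable_obs cov_linear_statistic_obs cov_contrast_obs sum_predictor_weights)
  \<comment> \<open>For \<open>i = j\<close> the identity
    \<open>(u + 1 / K) * (K * u / (K * u + 1)) = u\<close>, or the same with \<open>v\<close>, lets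
    the shrinkage part of the weight cancel \<open>contrast_obs_cov j\<close>.\<close>
  also have "\<dots> = error_obs_cov i j"
    using pos
    by (auto simp: response_var_def error_var_def contrast_obs_cov_def blup_weight_def
        error_obs_cov_def divide_simps) (simp_all add: algebra_simps)
  finally show ?thesis .
qed

text \<open>Individuals \<open>1\<close> and \<open>n1 + 1\<close> represent their groups, since
  \<open>error_obs_cov\<close> is constant in \<open>j\<close> on each; \<open>1\<close> lies in the
  first group because \<open>1 \<le> n1\<close>.\<close>

lemma cov_linear_statistic_prediction_error:
  assumes "i \<in> {1..n1 + n2}"
  shows "cov (P m) (linear_statistic c) (\<lambda>\<omega>. predictor i \<omega> - contrast i \<omega>)
    = error_obs_cov i 1 * (\<Sum>j = 1..n1. \<Sum>k = 1..K. c j k)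
      + error_obs_cov i (n1 + 1) * (\<Sum>j = n1 + 1..n1 + n2. \<Sum>k = 1..K. c j k)"
proof -
  have "cov (P m) (linear_statistic c) (\<lambda>\<omega>. predictor i \<omega> - contrast i \<omega>)
      = (\<Sum>j = 1..n1 + n2. \<Sum>k = 1..K. c j k * error_obs_cov i j)"
    unfolding cov_linear_statistic_left[OF square_integrable_diff[OF
        square_integrable_linear_statistic square_integrable_contrast[OF assms]]]
    by (intro sum.cong refl)
      (simp only: cov_commute[of _ "obs _ _"] cov_prediction_error_obs[OF assms])
  also have "\<dots> = (\<Sum>j = 1..n1. \<Sum>k = 1..K. c j k * error_obs_cov i 1)
      + (\<Sum>j = n1 + 1..n1 + n2. \<Sum>k = 1..K. c j k * error_obs_cov i (n1 + 1))"
    unfolding sum_individuals using sizes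
    by (intro arg_cong2[of _ _ _ _ "(+)"] sum.cong refl) (auto simp: error_obs_cov_def)
  finally show ?thesis
    by (simp only: sum_distrib_right[symmetric] mult.commute)
qed

text \<open>Pythagoras: a competing unbiased predictor is \<open>predictor i\<close> plus a
  statistic that is uncorrelated with the error of \<open>predictor i\<close>.\<close>

lemma mean_square_error_decomposition:
  assumes i: "i \<in> {1..n1 + n2}" and c: "unbiased_for (contrast i) (linear_statistic c)"
  defines "d \<equiv> \<lambda>j k. c j k - blup_weight i j / K"
  shows "(\<integral>\<omega>. (linear_statistic c \<omega> - contrast i \<omega>)\<^sup>2 \<partial>P m)
    = (\<integral>\<omega>. (predictor i \<omega> - contrast i \<omega>)\<^sup>2 \<partial>P m)
      + cov (P m) (linear_statistic d) (linear_statistic d)"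
proof -
  interpret prob_space "P m" by (rule prob)
  define R where "R = (\<lambda>\<omega>. predictor i \<omega> - contrast i \<omega>)"
  have sq [simp]: "square_integrable (P m) R" "square_integrable (P m) (linear_statistic d)"
    unfolding R_def
    by (intro square_integrable_diff square_integrable_linear_statistic
        square_integrable_contrast i)+
  have mean: "integral\<^sup>L (P m) (\<lambda>\<omega>. linear_statistic b \<omega> - contrast i \<omega>) = 0"
    if "unbiased_for (contrast i) (linear_statistic b)" for b
    using that[unfolded unbiased_for_def, rule_format, of m]
      integrable_if_square_integrable[OF square_integrable_linear_statistic[of m b]]
      integrable_if_square_integrable[OF square_integrable_contrast[OF i, of m]]
    by simp
  \<comment> \<open>Both weight families have group totals 1 and -1, so the totals of
    \<open>d\<close> vanish.\<close>
  have "cov (P m) (linear_statistic d) R = 0"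
    using c sum_blup_weight[OF i] sum_predictor_weights[of i]
    unfolding R_def cov_linear_statistic_prediction_error[OF i] unbiased_for_contrast_iff[OF i]
    by (simp add: d_def sum_subtractf del: sum_constant)
  moreover from this have "cov (P m) R (linear_statistic d) = 0"
    by (simp only: cov_commute[of _ R "linear_statistic d"])
  moreover have "(\<lambda>\<omega>. linear_statistic c \<omega> - contrast i \<omega>) = (\<lambda>\<omega>. R \<omega> + linear_statistic d \<omega>)"
    by (simp add: R_def d_def linear_statistic_def sum_subtractf left_diff_distrib)
  ultimately show ?thesis
    unfolding integral_square_eq_cov[OF mean[OF c]]
      integral_square_eq_cov[OF mean[OF unbiased_predictor[OF i]]]
    by (simp add: cov_add_left cov_add_right square_integrable_add R_def[symmetric])
qed

text \<open>An excess of zero in the decomposition forces equal weights. The best predictor is thus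
  unique as a function, which determines the choice made by \<open>blup\<close>.\<close>

lemma is_blup_contrast_iff:
  assumes i: "i \<in> {1..n1 + n2}"
  shows "is_blup (contrast i) Z \<longleftrightarrow> Z = predictor i"
proof
  assume Z: "is_blup (contrast i) Z"
  then obtain c where c: "Z = linear_statistic c"
    by (auto simp: is_blup_def linear_predictor_iff)
  define d where "d = (\<lambda>j k. c j k - blup_weight i j / K)"
  have le: "(\<integral>\<omega>. (Z \<omega> - contrast i \<omega>)\<^sup>2 \<partial>P m) \<le> (\<integral>\<omega>. (predictor i \<omega> - contrast i \<omega>)\<^sup>2 \<partial>P m)" for m
    using Z unbiased_predictor[OF i] unfolding is_blup_def linear_predictor_iff by blast
  have "unbiased_for (contrast i) (linear_statistic c)"
    using Z by (simp only: is_blup_def c)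
  then have "cov (P m) (linear_statistic d) (linear_statistic d) \<le> 0" for m
    using le[of m] mean_square_error_decomposition[OF i, of c m] unfolding c d_def by linarith
  then have "d j k = 0" if "j \<in> {1..n1 + n2}" "k \<in> {1..K}" for j k
    using var_linear_statistic_nonpos_imp_zero that by blast
  then show "Z = predictor i"
    unfolding c d_def linear_statistic_def[abs_def] by (intro ext sum.cong refl) simp
next
  assume Z: "Z = predictor i"
  have "(\<integral>\<omega>. (predictor i \<omega> - contrast i \<omega>)\<^sup>2 \<partial>P m) \<le> (\<integral>\<omega>. (Z' \<omega> - contrast i \<omega>)\<^sup>2 \<partial>P m)"
    if Z': "linear_predictor Z'" "unbiased_for (contrast i) Z'" for Z' m
  proof -
    obtain c where c: "Z' = linear_statistic c"
      using Z' by (auto simp: linear_predictor_iff)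
    have "0 \<le> cov (P m) (linear_statistic d) (linear_statistic d)" for d
      unfolding cov_def by (simp add: power2_eq_square[symmetric])
    then show ?thesis
      using mean_square_error_decomposition[OF i, of c m] Z' by (simp add: c)
  qed
  then show "is_blup (contrast i) Z"
    using unbiased_predictor[OF i] by (auto simp: is_blup_def linear_predictor_iff Z)
qed

section \<open>The covariance matrix of the prediction errors\<close>

lemma prediction_error_eq:
  assumes "i \<in> {1..n1 + n2}"
  shows "prediction_error i = (\<lambda>\<omega>. predictor i \<omega> - contrast i \<omega>)"
proof -
  have "is_blup (contrast i) = (\<lambda>Z. Z = predictor i)"
    by (rule ext) (rule is_blup_contrast_iff[OF assms])
  then show ?thesis
    by (simp add: prediction_error_def[abs_def] blup_def)
qed

text \<open>The diagonal part is the error variance that known population means would leave. The two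
  products come from estimating these means: \<open>s1 * (K * u + 1) / (K * n1)\<close> and
  \<open>s2 * (K * v + 1) / (K * n2)\<close> are the variances of the group means, and the factors
  \<open>1 / (K * u + 1)\<close> and \<open>1 / (K * v + 1)\<close> belong to observed
  responses.\<close>

lemma cov_prediction_error:
  assumes "i \<in> {1..n1 + n2}" "j \<in> {1..n1 + n2}"
  shows "cov (P m) (prediction_error i) (prediction_error j)
    = (if i = j then if i \<le> n1 then s1 * u / (K * u + 1) + s2 * v else s2 * v / (K * v + 1) + s1 * u
       else 0)
      + s1 * (K * u + 1) / (K * n1) * (if i \<le> n1 then 1 / (K * u + 1) else 1)
          * (if j \<le> n1 then 1 / (K * u + 1) else 1)
      + s2 * (K * v + 1) / (K * n2) * (if i \<le> n1 then 1 else 1 / (K * v + 1))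
          * (if j \<le> n1 then 1 else 1 / (K * v + 1))"
proof -
  interpret prob_space "P m" by (rule prob)
  have pos: "real K * u + 1 \<noteq> 0" "real K * v + 1 \<noteq> 0" "real n1 \<noteq> 0" "real n2 \<noteq> 0" "real K \<noteq> 0"
    using sizes dispersions by (auto simp: add_nonneg_eq_0_iff)
  let ?R = "\<lambda>\<omega>. predictor j \<omega> - contrast j \<omega>"
  have sq: "square_integrable (P m) ?R"
    by (intro square_integrable_diff square_integrable_linear_statistic
        square_integrable_contrast assms)
  have "cov (P m) (prediction_error i) (prediction_error j)
      = cov (P m) (predictor i) ?R - cov (P m) (contrast i) ?R"
    unfolding prediction_error_eq[OF assms(1)] prediction_error_eq[OF assms(2)]
    by (rule cov_diff_left[OF square_integrable_linear_statistic
          square_integrable_contrast[OF assms(1)] sq])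
  \<comment> \<open>The group totals 1 and -1 of the weights leave a difference of two group
    constants.\<close>
  also have "cov (P m) (predictor i) ?R = error_obs_cov j 1 - error_obs_cov j (n1 + 1)"
    unfolding cov_linear_statistic_prediction_error[OF assms(2)] sum_predictor_weights
      sum_blup_weight[OF assms(1)] by simp
  also have "cov (P m) (contrast i) ?R
      = contrast_obs_cov i * blup_weight j i - (if i = j then s1 * u + s2 * v else 0)"
    using assms
    by (simp only: cov_diff_right square_integrable_linear_statistic square_integrable_contrast
        cov_commute[of _ "contrast i" "predictor j"] cov_linear_statistic_contrast
        cov_contrast_contrast sum_predictor_weights)
  also have "error_obs_cov j 1 - error_obs_cov j (n1 + 1)
      - (contrast_obs_cov i * blup_weight j i - (if i = j then s1 * u + s2 * v else 0))
    = (if i = j then if i \<le> n1 then s1 * u / (K * u + 1) + s2 * v else s2 * v / (K * v + 1) + s1 * u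
       else 0)
      + s1 * (K * u + 1) / (K * n1) * (if i \<le> n1 then 1 / (K * u + 1) else 1)
          * (if j \<le> n1 then 1 / (K * u + 1) else 1)
      + s2 * (K * v + 1) / (K * n2) * (if i \<le> n1 then 1 else 1 / (K * v + 1))
          * (if j \<le> n1 then 1 else 1 / (K * v + 1))"
    using pos sizes
    by (auto simp: contrast_obs_cov_def blup_weight_def error_obs_cov_def divide_simps)
      (simp_all add: algebra_simps)
  finally show ?thesis .
qed

end

subsection \<open>Determinants\<close>

text \<open>Both sides equal the determinant of the block matrix \<open>?M\<close>: multiplying by
  \<open>?L\<close> from the right clears its lower left block, and \<open>?R * ?S\<close> factors
  it into a lower and an upper block triangular matrix.\<close>

lemma det_one_plus_mult_commute:
  fixes A B :: "'a :: idom mat"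
  assumes A: "A \<in> carrier_mat n k" and B: "B \<in> carrier_mat k n"
  shows "Determinant.det (1\<^sub>m n + A * B) = Determinant.det (1\<^sub>m k + B * A)"
proof -
  let ?M = "four_block_mat (1\<^sub>m n) (- A) B (1\<^sub>m k)"
  let ?L = "four_block_mat (1\<^sub>m n) (0\<^sub>m n k) (- B) (1\<^sub>m k)"
  let ?R = "four_block_mat (1\<^sub>m n) (0\<^sub>m n k) B (1\<^sub>m k)"
  let ?S = "four_block_mat (1\<^sub>m n) (- A) (0\<^sub>m k n) (1\<^sub>m k + B * A)"
  have M: "?M \<in> carrier_mat (n + k) (n + k)" by auto
  have "- A * - B = A * B" "- A * 1\<^sub>m k = - A" "B + - B = 0\<^sub>m k n" "B * - A = - (B * A)"
    using A B by (auto intro!: eq_matI simp: scalar_prod_def sum_negf)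
  then have "?M * ?L = four_block_mat (1\<^sub>m n + A * B) (- A) (0\<^sub>m k n) (1\<^sub>m k)"
    using A B by (subst mult_four_block_mat[of _ n n _ k _ k _ _ n _ k]) auto
  moreover have "Determinant.det ?L = 1"
    using B by (subst det_four_block_mat_upper_right_zero[of _ n _ k]) auto
  moreover have "Determinant.det (?M * ?L) = Determinant.det ?M * Determinant.det ?L"
    by (rule det_mult[OF M]) auto
  moreover have "Determinant.det (four_block_mat (1\<^sub>m n + A * B) (- A) (0\<^sub>m k n) (1\<^sub>m k))
      = Determinant.det (1\<^sub>m n + A * B)"
    using A B by (subst det_four_block_mat_lower_left_zero[of _ n _ k]) auto
  ultimately have 1: "Determinant.det ?M = Determinant.det (1\<^sub>m n + A * B)" by simp
  have "B * - A + (1\<^sub>m k + B * A) = 1\<^sub>m k"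
    using A B by (auto intro!: eq_matI simp: scalar_prod_def sum_negf)
  then have "?R * ?S = ?M"
    using A B by (subst mult_four_block_mat[of _ n n _ k _ k _ _ n _ k]) auto
  moreover have "Determinant.det ?R = 1"
    using B by (subst det_four_block_mat_upper_right_zero[of _ n _ k]) auto
  moreover have "Determinant.det (?R * ?S) = Determinant.det ?R * Determinant.det ?S"
    using A B by (intro det_mult[of _ "n + k"]) auto
  moreover have "Determinant.det ?S = Determinant.det (1\<^sub>m k + B * A)"
    using A B by (subst det_four_block_mat_lower_left_zero[of _ n _ k]) auto
  ultimately show ?thesis using 1 by simp
qed

lemma det_mat_2:
  "Determinant.det (mat 2 2 f) = f (0, 0) * f (1, 1) - f (0, 1) * f (1, 0)"
  for f :: "nat \<times> nat \<Rightarrow> 'a :: comm_ring_1"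
  by (subst laplace_expansion_column[of _ 2 0])
    (auto simp: numeral_2_eq_2 lessThan_Suc cofactor_def mat_delete_def det_single)

text \<open>The matrix is \<open>D * (1 + A * B)\<close>, where \<open>A\<close> has the columns
  \<open>x\<close> and \<open>y\<close> divided by \<open>d\<close> and \<open>B\<close> has the
  rows \<open>x'\<close> and \<open>y'\<close>. Commuting \<open>A\<close> and \<open>B\<close>
  leaves a 2 by 2 determinant.\<close>

lemma det_diag_plus_rank_two:
  fixes d x x' y y' :: "nat \<Rightarrow> 'a :: field"
  assumes d: "\<And>i. i < n \<Longrightarrow> d i \<noteq> 0"
  shows "Determinant.det (mat n n (\<lambda>(i, j). (if i = j then d i else 0) + x i * x' j + y i * y' j))
    = (\<Prod>i<n. d i) * ((1 + (\<Sum>i<n. x' i * x i / d i)) * (1 + (\<Sum>i<n. y' i * y i / d i))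
        - (\<Sum>i<n. x' i * y i / d i) * (\<Sum>i<n. y' i * x i / d i))"
    (is "Determinant.det ?M = _ * ?c")
proof -
  define D where "D = mat n n (\<lambda>(i, j). if i = j then d i else 0)"
  define A where "A = mat n 2 (\<lambda>(i, k). (if k = 0 then x i else y i) / d i)"
  define B where "B = mat 2 n (\<lambda>(k, j). if k = 0 then x' j else y' j)"
  have D: "D \<in> carrier_mat n n" and A: "A \<in> carrier_mat n 2" and B: "B \<in> carrier_mat 2 n"
    by (auto simp: D_def A_def B_def)
  have "?M = D * (1\<^sub>m n + A * B)"
  proof (rule eq_matI)
    fix i j assume "i < dim_row (D * (1\<^sub>m n + A * B))" "j < dim_col (D * (1\<^sub>m n + A * B))"
    then have ij: "i < n" "j < n" using D B by auto
    have "(D * (1\<^sub>m n + A * B)) $$ (i, j) = (\<Sum>k<n. (if i = k then d i else 0) *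
        ((if k = j then 1 else 0) + (x k / d k * x' j + y k / d k * y' j)))"
      using ij by (auto simp: D_def A_def B_def scalar_prod_def lessThan_atLeast0 numeral_2_eq_2
          intro!: sum.cong)
    also have "\<dots> = (\<Sum>k<n. if i = k then d i *
        ((if k = j then 1 else 0) + (x k / d k * x' j + y k / d k * y' j)) else 0)"
      by (intro sum.cong) auto
    also have "\<dots> = d i * ((if i = j then 1 else 0) + (x i / d i * x' j + y i / d i * y' j))"
      using ij by simp
    also have "\<dots> = (if i = j then d i else 0) + x i * x' j + y i * y' j"
      using d[OF ij(1)] by (auto simp: field_simps)
    finally show "?M $$ (i, j) = (D * (1\<^sub>m n + A * B)) $$ (i, j)"
      using ij by simp
  qed (use D B in auto)
  moreover have "Determinant.det (D * (1\<^sub>m n + A * B))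
      = Determinant.det D * Determinant.det (1\<^sub>m n + A * B)"
    using D A B by (intro det_mult[of _ n]) auto
  moreover have "Determinant.det D = (\<Prod>i<n. d i)"
    by (subst det_upper_triangular[OF _ D])
      (auto simp: D_def diag_mat_def prod.list_conv_set_nth lessThan_atLeast0)
  moreover have "1\<^sub>m 2 + B * A = mat 2 2 (\<lambda>(k, l). (if k = l then 1 else 0) +
      (\<Sum>i<n. (if k = 0 then x' i else y' i) * ((if l = 0 then x i else y i) / d i)))"
    by (rule eq_matI) (auto simp: A_def B_def scalar_prod_def lessThan_atLeast0)
  then have "Determinant.det (1\<^sub>m 2 + B * A) = ?c"
    by (simp add: det_mat_2)
  ultimately show ?thesis
    using det_one_plus_mult_commute[OF A B] by simp
qed

section \<open>Evaluation for two groups with equal error variances\<close>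

lemma prod_lessThan_add_if:
  fixes a b :: "'a :: comm_semiring_1"
  shows "(\<Prod>i<m + n. if i < m then a else b) = a ^ m * b ^ n"
  by (induction n) (simp_all add: ac_simps)

lemma sum_lessThan_add_if:
  fixes a b :: real and m n :: nat
  shows "(\<Sum>i<m + n. if i < m then a else b) = m * a + n * b"
  by (induction n) (simp_all add: algebra_simps)

text \<open>This is the remaining 2 by 2 determinant for group sizes \<open>m\<close> and
  \<open>n\<close>. With \<open>c = U * V - 1\<close> the diagonal product and the off-diagonal
  product share the factor \<open>(m + n)\<^sup>2 / (m * n * c\<^sup>2)\<close>, and
  \<open>(c + 1)\<^sup>2 - (c + 1) = c * (c + 1)\<close> cancels one \<open>c\<close>.\<close>

lemma rank_two_factor:
  fixes m n U V :: real
  assumes "m \<noteq> 0" "n \<noteq> 0" "U \<noteq> 0" "V \<noteq> 0" "U * V \<noteq> 1"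
  shows "(1 + U / m * (m / U + n * V) / (U * V - 1)) * (1 + V / n * (m * U + n / V) / (U * V - 1))
      - U / m * (m + n) / (U * V - 1) * (V / n * (m + n) / (U * V - 1))
    = U * V * (m + n)\<^sup>2 / (m * n * (U * V - 1))"
proof -
  define c where "c = U * V - 1"
  have c: "c \<noteq> 0" "U * V = c + 1" using assms by (auto simp: c_def)
  have "U / m * (m / U + n * V) = (m + n * (c + 1)) / m"
    and "V / n * (m * U + n / V) = (n + m * (c + 1)) / n"
    unfolding c(2)[symmetric] using assms by (simp_all add: field_simps)
  then have "1 + U / m * (m / U + n * V) / c = (c + 1) * (m + n) / (m * c)"
    and "1 + V / n * (m * U + n / V) / c = (c + 1) * (m + n) / (n * c)"
    using assms c(1) by (simp_all add: field_simps)
  moreover have "U / m * (m + n) / c * (V / n * (m + n) / c) = (U * V) * (m + n)\<^sup>2 / (m * n * c\<^sup>2)"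
    by (simp add: power2_eq_square ac_simps)
  moreover have "(c + 1) * (m + n) / (m * c) * ((c + 1) * (m + n) / (n * c))
      - (c + 1) * (m + n)\<^sup>2 / (m * n * c\<^sup>2) = (c + 1) * (m + n)\<^sup>2 / (m * n * c)"
    using assms c(1) by (simp add: divide_simps power2_eq_square) (simp add: algebra_simps)
  ultimately show ?thesis
    unfolding c_def[symmetric] by (simp only: c(2))
qed

lemma (in two_group_rcr) det_prediction_error_cov:
  fixes s U V t :: real
  assumes "s1 = s" "s2 = s"
  defines "U \<equiv> real K * u + 1" and "V \<equiv> real K * v + 1" and "t \<equiv> u + v + real K * u * v"
  shows "Determinant.det (prediction_error_cov m)
    = (s * t / U) ^ n1 * (s * t / V) ^ n2 * (U * V * (n1 + n2)\<^sup>2 / (n1 * n2 * (K * t)))"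
proof -
  have pos: "0 < s" "0 < u" "0 < v" "0 < real K" "0 < real n1" "0 < real n2"
    using dispersions sizes assms(1,2) by auto
  then have UV: "0 < U" "0 < V" "0 < t"
    by (simp_all add: U_def V_def t_def add_pos_pos)
  have Kt: "U * V - 1 = K * t"
    by (simp add: U_def V_def t_def algebra_simps)
  have UV1: "U * V \<noteq> 1"
    using Kt pos UV by auto
  \<comment> \<open>Index \<open>i\<close> stands for individual \<open>Suc i\<close>, so the first
    group is \<open>i < n1\<close>.\<close>
  define d where "d i = (if i < n1 then s * t / U else s * t / V)" for i
  define x where "x i = (if i < n1 then 1 / U else 1)" for i
  define y where "y i = (if i < n1 then 1 else 1 / V)" for i
  \<comment> \<open>The variances of the two group means.\<close>
  define a b where "a = s * U / (K * n1)" and "b = s * V / (K * n2)"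
  \<comment> \<open>Both numerators collapse to \<open>t\<close> because
    \<open>u + v * U = t\<close> and \<open>v + u * V = t\<close>.\<close>
  have dU: "s * u / U + s * v = s * t / U" and dV: "s * v / V + s * u = s * t / V"
    using UV by (simp_all add: field_simps) (simp_all add: U_def V_def t_def algebra_simps)
  \<comment> \<open>The scalars \<open>a\<close> and \<open>b\<close> are absorbed into the left
    vectors, as the determinant formula allows different left and right vectors.\<close>
  have "prediction_error_cov m = mat (n1 + n2) (n1 + n2)
      (\<lambda>(i, j). (if i = j then d i else 0) + (a * x i) * x j + (b * y i) * y j)"
    unfolding prediction_error_cov_def
  proof (intro cong_mat refl, clarify)
    fix i j assume ij: "i < n1 + n2" "j < n1 + n2"
    then have "Suc i \<in> {1..n1 + n2}" "Suc j \<in> {1..n1 + n2}" by auto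
    then show "cov (P m) (prediction_error (Suc i)) (prediction_error (Suc j))
        = (if i = j then d i else 0) + (a * x i) * x j + (b * y i) * y j"
      by (simp only: cov_prediction_error assms(1,2) d_def x_def y_def a_def b_def
          U_def[symmetric] V_def[symmetric] dU dV Suc_le_eq nat.inject cong: if_cong)
  qed
  then have "Determinant.det (prediction_error_cov m) = (\<Prod>i<n1 + n2. d i) *
      ((1 + (\<Sum>i<n1 + n2. x i * (a * x i) / d i)) * (1 + (\<Sum>i<n1 + n2. y i * (b * y i) / d i))
        - (\<Sum>i<n1 + n2. x i * (b * y i) / d i) * (\<Sum>i<n1 + n2. y i * (a * x i) / d i))"
    using pos UV by (simp only:) (rule det_diag_plus_rank_two, simp add: d_def)
  also have "(\<Prod>i<n1 + n2. d i) = (s * t / U) ^ n1 * (s * t / V) ^ n2"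
    unfolding d_def by (rule prod_lessThan_add_if)
  also have "(\<Sum>i<n1 + n2. x i * (a * x i) / d i) = U / n1 * (n1 / U + n2 * V) / (K * t)"
  proof -
    have split: "(\<Sum>i<n1 + n2. x i * (a * x i) / d i) = (\<Sum>i<n1 + n2. if i < n1 then a / (s * t * U) else a * V / (s * t))"
      using UV by (intro sum.cong) (auto simp: x_def d_def)
    show ?thesis
      unfolding split unfolding sum_lessThan_add_if a_def using UV pos by (simp add: field_simps)
  qed
  also have "(\<Sum>i<n1 + n2. y i * (b * y i) / d i) = V / n2 * (n1 * U + n2 / V) / (K * t)"
  proof -
    have split: "(\<Sum>i<n1 + n2. y i * (b * y i) / d i) = (\<Sum>i<n1 + n2. if i < n1 then b * U / (s * t) else b / (s * t * V))"
      using UV by (intro sum.cong) (auto simp: y_def d_def)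
    show ?thesis
      unfolding split unfolding sum_lessThan_add_if b_def using UV pos by (simp add: field_simps)
  qed
  also have "(\<Sum>i<n1 + n2. x i * (b * y i) / d i) = V / n2 * (n1 + n2) / (K * t)"
  proof -
    have split: "(\<Sum>i<n1 + n2. x i * (b * y i) / d i) = (\<Sum>i<n1 + n2. if i < n1 then b / (s * t) else b / (s * t))"
      using UV by (intro sum.cong) (auto simp: x_def y_def d_def)
    show ?thesis
      unfolding split unfolding sum_lessThan_add_if b_def using UV pos by (simp add: field_simps)
  qed
  also have "(\<Sum>i<n1 + n2. y i * (a * x i) / d i) = U / n1 * (n1 + n2) / (K * t)"
  proof -
    have split: "(\<Sum>i<n1 + n2. y i * (a * x i) / d i) = (\<Sum>i<n1 + n2. if i < n1 then a / (s * t) else a / (s * t))"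
      using UV by (intro sum.cong) (auto simp: x_def y_def d_def)
    show ?thesis
      unfolding split unfolding sum_lessThan_add_if a_def using UV pos by (simp add: field_simps)
  qed
  also have "(1 + U / n1 * (n1 / U + n2 * V) / (K * t)) * (1 + V / n2 * (n1 * U + n2 / V) / (K * t))
      - V / n2 * (n1 + n2) / (K * t) * (U / n1 * (n1 + n2) / (K * t))
    = U * V * (n1 + n2)\<^sup>2 / (n1 * n2 * (K * t))"
    using rank_two_factor[of n1 n2 U V] UV UV1 pos Kt by (simp add: mult.commute)
  finally show ?thesis .
qed

text \<open>With \<open>w = n1 / N\<close> the factor \<open>(n1 + n2)\<^sup>2 / (n1 * n2)\<close>
  becomes \<open>1 / (w * (1 - w))\<close>, and the ratio \<open>V / U\<close> of the diagonal
  values gives the slope in \<open>w\<close>.\<close>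

lemma (in two_group_rcr) D_criterion_eq_approx:
  assumes "s1 = s" "s2 = s" "n1 + n2 = N"
  shows "D_criterion m = D_criterion_approx N K u v
    (real N * ln (s * (u + v + K * u * v) / (K * v + 1))
      + ln ((K * u + 1) * (K * v + 1) / (K * (u + v + K * u * v)))) (n1 / N)"
proof -
  define U V t where "U = real K * u + 1" and "V = real K * v + 1" and "t = u + v + K * u * v"
  have pos: "0 < s" "0 < u" "0 < v" "0 < real K" "0 < real n1" "0 < real n2"
    using dispersions sizes assms(1,2) by auto
  then have UV: "0 < U" "0 < V" "0 < t"
    by (simp_all add: U_def V_def t_def add_pos_pos)
  have N: "real N = n1 + n2" "0 < real N" using assms(3) pos by auto
  define w where "w = n1 / N"
  have w: "1 - w = n2 / N" "0 < w" "0 < n2 / real N"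
    using N pos by (simp_all add: w_def field_simps)
  have "D_criterion m = ln ((s * t / U) ^ n1 * (s * t / V) ^ n2 * (U * V / (K * t) / (w * (1 - w))))"
    unfolding D_criterion_def det_prediction_error_cov[OF assms(1,2)] U_def[symmetric]
      V_def[symmetric] t_def[symmetric] w(1)
    using N by (simp add: w_def power2_eq_square ac_simps)
  also have "\<dots> = n1 * ln (s * t / U) + n2 * ln (s * t / V) + (ln (U * V / (K * t)) - ln (w * (1 - w)))"
    using pos UV w N(2) by (simp add: ln_mult_pos ln_div ln_realpow)
  \<comment> \<open>The diagonal value of the second group serves as reference, so that its
    multiplicities add up to \<open>N\<close>.\<close>
  also have "ln (s * t / U) = ln (s * t / V) + ln (V / U)"
    using pos UV by (simp add: ln_mult_pos ln_div)
  also have "n1 * (ln (s * t / V) + ln (V / U)) + n2 * ln (s * t / V)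
      = N * ln (s * t / V) + w * N * ln (V / U)"
  proof -
    have "w * N = n1"
      using N(2) by (simp add: w_def)
    then show ?thesis
      by (simp only: N(1)) (simp add: algebra_simps)
  qed
  finally show ?thesis
    by (simp add: D_criterion_approx_def U_def V_def t_def w_def)
qed

subsection \<open>The optimal allocation rate\<close>

text \<open>The assumption on \<open>a\<close> says that the derivative vanishes at
  \<open>w0\<close>. Uniqueness follows because \<open>g\<close> vanishes only at 1.\<close>

lemma is_arg_min_linear_minus_log:
  fixes w0 :: real
  assumes "0 < w0" "w0 < 1" and a: "a = 1 / w0 - 1 / (1 - w0)"
    and f: "\<And>w. f w = b + w * a - ln (w * (1 - w))"
  shows "is_arg_min f (\<lambda>w. 0 < w \<and> w < 1) w \<longleftrightarrow> w = w0"
proof -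
  define g where "g x = x - 1 - ln x" for x :: real
  have g_nonneg: "0 \<le> g x" if "0 < x" for x
    using ln_le_minus_one[OF that] by (simp add: g_def)
  have diff: "f w - f w0 = g (w / w0) + g ((1 - w) / (1 - w0))" if "0 < w" "w < 1" for w
  proof -
    have "a * (w - w0) = (w / w0 - 1) + ((1 - w) / (1 - w0) - 1)"
      using assms(1,2) by (simp add: a field_simps)
    moreover have "ln (w / w0) = ln w - ln w0" "ln ((1 - w) / (1 - w0)) = ln (1 - w) - ln (1 - w0)"
        "ln (w * (1 - w)) = ln w + ln (1 - w)" "ln (w0 * (1 - w0)) = ln w0 + ln (1 - w0)"
      using that assms(1,2) by (simp_all add: ln_div ln_mult)
    ultimately show ?thesis
      unfolding f g_def by (simp add: algebra_simps)
  qed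
  have "f w0 < f w" if w: "0 < w" "w < 1" "w \<noteq> w0" for w
  proof -
    have "g (w / w0) \<noteq> 0"
      using ln_eq_minus_one[of "w / w0"] w assms(1) by (auto simp: g_def)
    then show ?thesis
      using diff[OF w(1,2)] g_nonneg[of "w / w0"] g_nonneg[of "(1 - w) / (1 - w0)"] w assms(1,2)
      by simp
  qed
  then show ?thesis
    using assms(1,2) unfolding is_arg_min_def by (metis less_asym)
qed

text \<open>Clearing denominators in the stationarity condition gives
  \<open>a * w\<^sup>2 - (a + 2) * w + 1 = 0\<close>, of which \<open>w\<close> is a root.
  Rationalising to \<open>2 / (a + 2 + S)\<close> shows \<open>0 < w\<close> and
  \<open>w < 1\<close> for both signs of \<open>a\<close>.\<close>

lemma optimal_rate:
  fixes a :: real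
  assumes "a \<noteq> 0"
  defines "w \<equiv> 1 / (2 * a) * (a + 2 - sqrt (a\<^sup>2 + 4))"
  shows "0 < w" "w < 1" "a = 1 / w - 1 / (1 - w)"
proof -
  define S where "S = sqrt (a\<^sup>2 + 4)"
  have S2: "S\<^sup>2 = a\<^sup>2 + 4" by (simp add: S_def)
  have "\<bar>a\<bar> < S"
    unfolding S_def by (rule real_less_rsqrt) simp
  then have S: "0 < S + a" "0 < S - a" by auto
  have "(a + 2 - S) * (a + 2 + S) = 4 * a"
    using S2 by (simp add: algebra_simps power2_eq_square)
  then have "w * (a + 2 + S) = 2"
    using assms(1) by (simp add: w_def S_def)
  then have w: "w = 2 / (a + 2 + S)"
    using S by (simp add: eq_divide_eq)
  have w': "1 - w = (a + S) / (a + 2 + S)"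
    using S by (simp add: w field_simps)
  show "0 < w" "w < 1" using S w by auto
  \<comment> \<open>The conjugate turns \<open>1 / (1 - w)\<close> into an expression linear in
    \<open>S\<close>, in which \<open>1 / w\<close> already is linear; \<open>S\<close> then cancels
    in the difference.\<close>
  have "(S + a) * (S - a) = 4"
    using S2 by (simp add: algebra_simps power2_eq_square)
  then have "2 / (a + S) = (S - a) / 2"
    using S by (simp add: field_simps)
  then have "1 / (1 - w) = 1 + (S - a) / 2"
    using S by (simp add: w' add_divide_distrib[symmetric] field_simps)
  moreover have "1 / w = (a + 2 + S) / 2" by (simp add: w)
  ultimately show "a = 1 / w - 1 / (1 - w)" by (simp add: field_simps)
qed

text \<open>The first conjunct ties the extended criterion to the determinant of the error
  covariance at every exact design; as \<open>b\<close> is chosen before the model, the split and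
  \<open>m\<close>, it is a genuine constant.\<close>

theorem theorem6:
  fixes N K :: nat and s1 s2 u v a :: real
  assumes "2 \<le> N" and "1 \<le> K"
    and "0 < s1" and "0 < s2" and "0 < u" and "0 < v"
    and "s1 = s2" and "u \<noteq> v"
    and "a = real N * ln ((real K * v + 1) / (real K * u + 1))"
  shows "\<exists>b.
    (\<forall>(P :: real \<times> real \<Rightarrow> 'a measure) n1 n2 mu1 mu2 eps m.
      n1 + n2 = N \<and> two_group_rcr P n1 n2 K s1 s2 u v mu1 mu2 eps \<longrightarrow>
        two_group_rcr.D_criterion P n1 n2 K mu1 mu2 eps m
          = D_criterion_approx N K u v b (real n1 / real N)) \<and>
    (\<forall>w. is_arg_min (D_criterion_approx N K u v b) (\<lambda>w. 0 < w \<and> w < 1) w \<longleftrightarrow>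
      w = 1 / (2 * a) * (a + 2 - sqrt (a\<^sup>2 + 4)))"
proof -
  define b where "b = real N * ln (s1 * (u + v + K * u * v) / (K * v + 1))
      + ln ((K * u + 1) * (K * v + 1) / (K * (u + v + K * u * v)))"
  have pos: "0 < real K * u + 1" "0 < real K * v + 1"
    using assms(5,6) by (simp_all add: add_nonneg_pos)
  \<comment> \<open>From \<open>u \<noteq> v\<close>: the logarithm is then nonzero, and so is the
    denominator \<open>2 * a\<close> of the optimal rate.\<close>
  have "(real K * v + 1) / (real K * u + 1) \<noteq> 1"
    using pos assms(2,8) by simp
  then have "a \<noteq> 0"
    using pos assms(1) by (simp add: assms(9))
  note rate = optimal_rate[OF this]
  have "is_arg_min (D_criterion_approx N K u v b) (\<lambda>w. 0 < w \<and> w < 1) w \<longleftrightarrow>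
      w = 1 / (2 * a) * (a + 2 - sqrt (a\<^sup>2 + 4))" for w
    by (rule is_arg_min_linear_minus_log[OF rate])
      (simp add: D_criterion_approx_def assms(9))
  moreover have "two_group_rcr.D_criterion P n1 n2 K mu1 mu2 eps m
      = D_criterion_approx N K u v b (real n1 / real N)"
    if "n1 + n2 = N" "two_group_rcr P n1 n2 K s1 s2 u v mu1 mu2 eps"
    for P :: "real \<times> real \<Rightarrow> 'a measure" and n1 n2 mu1 mu2 eps m
    unfolding b_def
    by (rule two_group_rcr.D_criterion_eq_approx[OF that(2) refl assms(7)[symmetric] that(1)])
  ultimately show ?thesis by blast
qed

end
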